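(* Let $d\geq 1$ and let $\varphi$ be a partial $d$-edge coloring of $Q_d$. Let $a(d)$ and $b(d)$ be functions satisfying $\frac{109}{1776}d^2 - 2b(d)\left(a(d)-\frac{7d}{8}\right)\geq 0$ and $a(d)\geq b(d)$. (i) If every color appears on at most $d/8$ edges under $\varphi$, every edge of $Q_d$ is parallel to at most $b(d)$ other $\varphi$-colored edges, and every dimensional matching of $Q_d$ contains at most $a(d)$ $\varphi$-colored edges, then $\varphi$ is avoidable. (ii) For every constant $C_1\geq 1$, setting $C_2 = 2C_1(C_1+2)\cdot 34^2$, if every dimensional matching of $Q_d$ contains at most $C_1 d$ $\varphi$-colored edges and every color appears on at most $d/C_2$ edges under $\varphi$, then $\varphi$ is avoidable.
   Context: $Q_d$ is the $d$-dimensional hypercube (vertex set $\{0,1\}^d$, two vertices adjacent iff they differ in exactly one coordinate). For $i=1,\dots,d$, the $i$-th dimensional matching of $Q_d$ is the perfect matching consisting of all edges whose endpoints differ in coordinate $i$. Two edges of $Q_d$ are parallel if they are non-adjacent and lie on a common $4$-cycle. A partial $d$-edge coloring of $Q_d$ assigns colors from $\{1,\dots,d\}$ to some subset of edges (not necessarily properly); it is avoidable if there is a proper $d$-edge coloring $f$ of $Q_d$ with colors $1,\dots,d$ such that $f(e)\neq\varphi(e)$ for every $\varphi$-colored edge $e$. *)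

theory Defs
  imports Complex_Main "HOL-Library.FuncSet"
begin

text \<open>Vertices are 0/1-valued functions on the coordinates \<open>1, \<dots>, d\<close>, extensional so that each
  vertex is represented exactly once; an edge is the two-element set of its endpoints.\<close>

type_synonym vertex = "nat \<Rightarrow> nat"
type_synonym edge = "vertex set"

definition Q_verts :: "nat \<Rightarrow> vertex set" where
  "Q_verts d = ({1..d} \<rightarrow>\<^sub>E {0, 1})"

definition Q_adj :: "nat \<Rightarrow> vertex \<Rightarrow> vertex \<Rightarrow> bool" where
  "Q_adj d u v \<longleftrightarrow> u \<in> Q_verts d \<and> v \<in> Q_verts d \<and> card {i \<in> {1..d}. u i \<noteq> v i} = 1"

definition Q_edges :: "nat \<Rightarrow> edge set" where
  "Q_edges d = {{u, v} | u v. Q_adj d u v}"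

definition dim_matching :: "nat \<Rightarrow> nat \<Rightarrow> edge set" where
  "dim_matching d i = {{u, v} | u v. Q_adj d u v \<and> u i \<noteq> v i}"

definition edges_adjacent :: "edge \<Rightarrow> edge \<Rightarrow> bool" where
  "edges_adjacent e e' \<longleftrightarrow> e \<noteq> e' \<and> e \<inter> e' \<noteq> {}"

definition four_cycles :: "nat \<Rightarrow> edge set set" where
  "four_cycles d = {{{w, x}, {x, y}, {y, z}, {z, w}} | w x y z.
     distinct [w, x, y, z] \<and> Q_adj d w x \<and> Q_adj d x y \<and> Q_adj d y z \<and> Q_adj d z w}"

definition parallel :: "nat \<Rightarrow> edge \<Rightarrow> edge \<Rightarrow> bool" where
  "parallel d e e' \<longleftrightarrow> e \<noteq> e' \<and> \<not> edges_adjacent e e' \<and> (\<exists>C \<in> four_cycles d. e \<in> C \<and> e' \<in> C)"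

definition partial_edge_coloring :: "nat \<Rightarrow> (edge \<rightharpoonup> nat) \<Rightarrow> bool" where
  "partial_edge_coloring d \<phi> \<longleftrightarrow> dom \<phi> \<subseteq> Q_edges d \<and> ran \<phi> \<subseteq> {1..d}"

definition proper_edge_coloring :: "nat \<Rightarrow> (edge \<Rightarrow> nat) \<Rightarrow> bool" where
  "proper_edge_coloring d f \<longleftrightarrow> f \<in> Q_edges d \<rightarrow> {1..d} \<and>
     (\<forall>e \<in> Q_edges d. \<forall>e' \<in> Q_edges d. edges_adjacent e e' \<longrightarrow> f e \<noteq> f e')"

definition avoidable :: "nat \<Rightarrow> (edge \<rightharpoonup> nat) \<Rightarrow> bool" where
  "avoidable d \<phi> \<longleftrightarrow> (\<exists>f. proper_edge_coloring d f \<and> (\<forall>e \<in> dom \<phi>. \<phi> e \<noteq> Some (f e)))"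

end

theory Submission
  imports Defs "HOL-Combinatorics.Permutations"
begin

text \<open>Give every edge of direction \<open>i\<close> the color \<open>p i\<close> for a random permutation \<open>p\<close> of the
  directions, and let \<open>m < d / 5\<close> bound the number of edges that are precolored with any one color.
  The expected number of conflict edges is at most \<open>m\<close>, and so is the expected number of pairs of
  a conflict edge \<open>e\<close> and a direction \<open>j\<close> for which the translate of \<open>e\<close> along \<open>j\<close> is
  precolored \<open>p j\<close>. For a \<open>p\<close> that is no worse than average, every conflict edge \<open>e\<close> can
  greedily be given a direction \<open>j\<close> such that the 4-cycles spanned by \<open>e\<close> and \<open>j\<close> are
  edge-disjoint and exchanging the two colors on each of them removes all conflicts and creates no
  new one.\<close>

subsection \<open>Counting and greedy choice\<close>

lemma card_dom_le_if_fibers_le: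
  fixes f :: "'a \<rightharpoonup> 'b"
  assumes "ran f \<subseteq> C" "finite C" "\<And>c. c \<in> C \<Longrightarrow> card {x. f x = Some c} \<le> m"
  shows "card (dom f) \<le> card C * m"
proof -
  have "dom f = (\<Union>c\<in>C. {x. f x = Some c})"
    using assms(1) by (auto intro: ranI)
  then have "card (dom f) \<le> (\<Sum>c\<in>C. card {x. f x = Some c})"
    using card_UN_le[OF assms(2)] by metis
  also have "\<dots> \<le> card C * m"
    using sum_bounded_above[of C "\<lambda>c. card {x. f x = Some c}" m] assms(3) by simp
  finally show ?thesis .
qed

lemma sum_card_le_double_counting:
  assumes "finite A" "finite B" "\<And>b. b \<in> B \<Longrightarrow> card {a \<in> A. R a b} \<le> k"
  shows "(\<Sum>a\<in>A. card {b \<in> B. R a b}) \<le> card B * k"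
proof -
  have "(\<Sum>a\<in>A. card {b \<in> B. R a b}) = (\<Sum>b\<in>B. card {a \<in> A. R a b})"
    using assms(1,2) by (intro sum_multicount_gen) auto
  also have "\<dots> \<le> card B * k"
    using sum_bounded_above[of B "\<lambda>b. card {a \<in> A. R a b}" k] assms(3) by simp
  finally show ?thesis .
qed

lemma card_permutes_prescribed_le:
  fixes h :: "'a \<rightharpoonup> 'a"
  assumes "finite S" "I \<subseteq> S"
  shows "card {p. p permutes S \<and> (\<forall>i\<in>I. h i = Some (p i))} \<le> fact (card S - card I)"
proof -
  have "finite I" using assms finite_subset by blast
  then show ?thesis
    using assms
  proof (induction I arbitrary: S h rule: finite_induct)
    case empty
    then show ?case by (simp add: card_permutations)
  next
    case (insert i I)
    define t where "t = transpose i (the (h i))"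
    let ?P = "{p. p permutes S \<and> (\<forall>k\<in>insert i I. h k = Some (p k))}"
    let ?Q = "{p. p permutes S - {i} \<and> (\<forall>k\<in>I. map_option t (h k) = Some (p k))}"
    have "(\<circ>) t ` ?P \<subseteq> ?Q"
      using permutes_insert_lemma[of _ i "S - {i}"] insert.prems by (auto simp: t_def insert_absorb)
    moreover have "inj_on ((\<circ>) t) ?P"
      unfolding t_def by (rule inj_onI) (metis comp_assoc id_comp transpose_comp_involutory)
    moreover have "finite ?Q"
      using insert.prems by (intro finite_subset[OF _ finite_permutations[of "S - {i}"]]) auto
    ultimately have "card ?P \<le> card ?Q"
      by (intro card_inj_on_le)
    also have "\<dots> \<le> fact (card (S - {i}) - card I)"
      using insert.hyps insert.prems by (intro insert.IH) auto
    also have "card (S - {i}) - card I = card S - card (insert i I)"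
      using insert.hyps insert.prems by simp
    finally show ?case .
  qed
qed

lemma card_permutes_prescribed_two_le:
  assumes "finite S" "i \<in> S" "j \<in> S" "i \<noteq> j"
  shows "card {p. p permutes S \<and> x = Some (p i) \<and> y = Some (p j)} \<le> fact (card S - 2)"
  using card_permutes_prescribed_le[of S "{i, j}" "\<lambda>k. if k = i then x else y"] assms
  by (simp add: numeral_2_eq_2)

lemma ex_pairwise_compatible_choice:
  fixes clash :: "'a \<Rightarrow> 'b \<Rightarrow> 'a \<Rightarrow> 'b \<Rightarrow> bool"
  assumes "finite K"
    and sym: "\<And>x a y b. clash x a y b \<Longrightarrow> clash y b x a"
    and "\<And>x y b. x \<in> K \<Longrightarrow> y \<in> K \<Longrightarrow> b \<in> A y \<Longrightarrow> card {a \<in> A x. clash x a y b} \<le> m"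
    and "\<And>x. x \<in> K \<Longrightarrow> m * (card K - 1) < card (A x)"
  shows "\<exists>f \<in> Pi K A. pairwise (\<lambda>x y. \<not> clash x (f x) y (f y)) K"
  using assms(1,3,4)
proof (induction K rule: finite_induct)
  case empty
  then show ?case by simp
next
  case (insert x K)
  have card_insert: "card (insert x K) - 1 = card K"
    using insert.hyps by simp
  have "m * (card K - 1) < card (A y)" if "y \<in> K" for y
    using insert.prems(2)[of y] that unfolding card_insert
    by (meson diff_le_self insertI2 le_less_trans mult_le_mono2)
  then obtain f where f: "f \<in> Pi K A" "pairwise (\<lambda>x y. \<not> clash x (f x) y (f y)) K"
    using insert.IH insert.prems(1) by blast
  let ?U = "\<Union>y\<in>K. {a \<in> A x. clash x a y (f y)}"
  have "card ?U \<le> (\<Sum>y\<in>K. card {a \<in> A x. clash x a y (f y)})"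
    using insert.hyps(1) by (rule card_UN_le)
  also have "\<dots> \<le> m * card K"
    using sum_bounded_above[of K "\<lambda>y. card {a \<in> A x. clash x a y (f y)}" m] insert.prems(1) f(1)
    by (auto simp: mult.commute Pi_iff)
  also have "\<dots> < card (A x)"
    using insert.prems(2)[of x] unfolding card_insert by simp
  finally have less: "card ?U < card (A x)" .
  then have "finite (A x)" by (intro card_ge_0_finite) linarith
  then have "finite ?U" using insert.hyps(1) by auto
  then have "\<not> A x \<subseteq> ?U" using less card_mono leD by blast
  then obtain a where a: "a \<in> A x" "\<And>y. y \<in> K \<Longrightarrow> \<not> clash x a y (f y)"
    by blast
  then have a_sym: "\<And>y. y \<in> K \<Longrightarrow> \<not> clash y (f y) x a" using sym by blast
  have "pairwise (\<lambda>y z. \<not> clash y ((f(x := a)) y) z ((f(x := a)) z)) (insert x K)"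
    using f(2) a(2) a_sym insert.hyps(2) by (auto simp: pairwise_insert pairwise_def)
  moreover have "f(x := a) \<in> Pi (insert x K) A"
    using f(1) a(1) by auto
  ultimately show ?case by blast
qed

subsection \<open>Edges of the hypercube by direction\<close>

definition flip :: "nat \<Rightarrow> vertex \<Rightarrow> vertex" where
  "flip i v = v(i := 1 - v i)"

definition dir_edge :: "nat \<Rightarrow> vertex \<Rightarrow> edge" where
  "dir_edge i v = {v, flip i v}"

definition edge_dir :: "edge \<Rightarrow> nat" where
  "edge_dir e = (THE i. \<exists>v. e = dir_edge i v)"

lemma Q_verts_value: "v \<in> Q_verts d \<Longrightarrow> i \<in> {1..d} \<Longrightarrow> v i = 0 \<or> v i = 1"
  unfolding Q_verts_def using PiE_mem[of v "{1..d}" "\<lambda>_. {0, 1}" i] by blast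

lemma flip_in_Q_verts:
  assumes "v \<in> Q_verts d" "i \<in> {1..d}"
  shows "flip i v \<in> Q_verts d"
proof -
  have "flip i v \<in> insert i {1..d} \<rightarrow>\<^sub>E {0, 1}"
    unfolding flip_def using assms Q_verts_value[OF assms]
    by (intro PiE_fun_upd) (auto simp: Q_verts_def)
  with assms(2) show ?thesis by (simp add: Q_verts_def insert_absorb)
qed

lemma flip_flip: "v \<in> Q_verts d \<Longrightarrow> i \<in> {1..d} \<Longrightarrow> flip i (flip i v) = v"
  using Q_verts_value[of v d i] by (auto simp: flip_def)

lemma flip_commute: "flip i (flip j v) = flip j (flip i v)"
  by (auto simp: flip_def fun_upd_twist)

lemma flip_apply_neq_iff: "flip i v k \<noteq> v k \<longleftrightarrow> k = i"
  by (cases "v i") (auto simp: flip_def)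

lemma flip_eq_flip_iff: "flip i v = flip j v \<longleftrightarrow> i = j"
  using flip_apply_neq_iff by metis

lemma Q_adj_iff: "Q_adj d u v \<longleftrightarrow> u \<in> Q_verts d \<and> (\<exists>i\<in>{1..d}. v = flip i u)"
proof
  assume "Q_adj d u v"
  then have u: "u \<in> Q_verts d" and v: "v \<in> Q_verts d"
    and "card {i \<in> {1..d}. u i \<noteq> v i} = 1"
    by (auto simp: Q_adj_def)
  then obtain i where i: "{k \<in> {1..d}. u k \<noteq> v k} = {i}"
    by (auto simp: card_1_singleton_iff)
  then have i_in: "i \<in> {1..d}" by blast
  have "v = flip i u"
  proof (rule PiE_ext)
    show "v \<in> {1..d} \<rightarrow>\<^sub>E {0, 1}" "flip i u \<in> {1..d} \<rightarrow>\<^sub>E {0, 1}"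
      using v flip_in_Q_verts[OF u i_in] by (simp_all add: Q_verts_def)
    fix k assume k: "k \<in> {1..d}"
    then have "u k \<noteq> v k \<longleftrightarrow> k = i" using i by blast
    then show "v k = flip i u k"
      using Q_verts_value[OF u k] Q_verts_value[OF v k] by (auto simp: flip_def)
  qed
  with u i_in show "u \<in> Q_verts d \<and> (\<exists>i\<in>{1..d}. v = flip i u)" by blast
next
  assume "u \<in> Q_verts d \<and> (\<exists>i\<in>{1..d}. v = flip i u)"
  then obtain i where u: "u \<in> Q_verts d" and i: "i \<in> {1..d}" and v: "v = flip i u"
    by blast
  have "{k \<in> {1..d}. u k \<noteq> v k} = {i}"
    using i flip_apply_neq_iff[of i u] unfolding v by fastforce
  then show "Q_adj d u v"
    using u i v flip_in_Q_verts by (simp add: Q_adj_def)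
qed

lemma Q_edges_eq: "Q_edges d = (\<lambda>(i, v). dir_edge i v) ` ({1..d} \<times> Q_verts d)"
  unfolding Q_edges_def dir_edge_def Q_adj_iff by force

lemma Q_edgesE:
  assumes "e \<in> Q_edges d"
  obtains i v where "i \<in> {1..d}" "v \<in> Q_verts d" "e = dir_edge i v"
  using assms unfolding Q_edges_eq by auto

lemma finite_Q_edges: "finite (Q_edges d)"
proof -
  have "finite (Q_verts d)"
    unfolding Q_verts_def by (intro finite_PiE) auto
  then show ?thesis by (simp add: Q_edges_eq)
qed

lemma dir_edge_eqD:
  assumes "dir_edge i v = dir_edge j w"
  shows "i = j" "v \<in> dir_edge j w"
proof -
  have "(v = w \<and> flip i v = flip j w) \<or> (v = flip j w \<and> flip i v = w)"
    using assms unfolding dir_edge_def doubleton_eq_iff by blast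
  then show "i = j" using flip_apply_neq_iff by metis
  show "v \<in> dir_edge j w" unfolding assms[symmetric] by (simp add: dir_edge_def)
qed

lemma dir_edge_eq_iff:
  assumes "w \<in> Q_verts d" "j \<in> {1..d}"
  shows "dir_edge i v = dir_edge j w \<longleftrightarrow> i = j \<and> v \<in> dir_edge j w"
proof
  assume "i = j \<and> v \<in> dir_edge j w"
  then show "dir_edge i v = dir_edge j w"
    using flip_flip[OF assms] by (auto simp: dir_edge_def)
qed (use dir_edge_eqD in blast)

lemma edge_dir_dir_edge [simp]: "edge_dir (dir_edge i v) = i"
  unfolding edge_dir_def by (rule the_equality) (auto dest: dir_edge_eqD(1))

lemma edge_dir_in_range: "e \<in> Q_edges d \<Longrightarrow> edge_dir e \<in> {1..d}"
  by (erule Q_edgesE) simp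

lemma edge_at_vertex:
  assumes "e \<in> Q_edges d" "v \<in> e"
  shows "v \<in> Q_verts d" "dir_edge (edge_dir e) v = e"
proof -
  obtain i w where w: "i \<in> {1..d}" "w \<in> Q_verts d" "e = dir_edge i w"
    using assms(1) by (rule Q_edgesE)
  show "v \<in> Q_verts d"
    using assms(2) w flip_in_Q_verts by (auto simp: dir_edge_def)
  show "dir_edge (edge_dir e) v = e"
    using assms(2) w by (simp add: dir_edge_eq_iff)
qed

lemma image_flip_dir_edge: "flip j ` dir_edge i v = dir_edge i (flip j v)"
  by (simp add: dir_edge_def flip_commute)

lemma edge_dir_image_flip: "e \<in> Q_edges d \<Longrightarrow> edge_dir (flip j ` e) = edge_dir e"
  by (erule Q_edgesE) (simp add: image_flip_dir_edge)

lemma image_flip_eqD: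
  assumes "e \<in> Q_edges d" "j \<noteq> edge_dir e" "l \<noteq> edge_dir e" "flip j ` e = flip l ` e"
  shows "j = l"
proof -
  obtain i v where e: "e = dir_edge i v"
    using assms(1) by (rule Q_edgesE)
  have "flip j v \<in> dir_edge i (flip l v)"
    using assms(4) unfolding e image_flip_dir_edge by (rule dir_edge_eqD)
  moreover have "flip j v \<noteq> flip i (flip l v)"
  proof -
    have "flip j v i = v i" "flip l v i = v i"
      using assms(2,3) flip_apply_neq_iff unfolding e edge_dir_dir_edge by metis+
    then show ?thesis using flip_apply_neq_iff by metis
  qed
  ultimately show ?thesis by (simp add: dir_edge_def flip_eq_flip_iff)
qed

lemma image_flip_neq:
  assumes "e \<in> Q_edges d" "j \<noteq> edge_dir e"
  shows "flip j ` e \<noteq> e"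
proof
  assume "flip j ` e = e"
  moreover obtain i v where e: "e = dir_edge i v"
    using assms(1) by (rule Q_edgesE)
  ultimately have "flip j v \<in> {v, flip i v}"
    by (auto simp: dir_edge_def)
  then show False
    using assms(2) flip_apply_neq_iff[of j v j] by (auto simp: e flip_eq_flip_iff)
qed

lemma proper_edge_coloringI:
  assumes range: "\<And>e. e \<in> Q_edges d \<Longrightarrow> f e \<in> {1..d}"
    and inj: "\<And>v. v \<in> Q_verts d \<Longrightarrow> inj_on (\<lambda>i. f (dir_edge i v)) {1..d}"
  shows "proper_edge_coloring d f"
proof -
  have "f e \<noteq> f e'" if e: "e \<in> Q_edges d" "e' \<in> Q_edges d" "edges_adjacent e e'" for e e'
  proof
    assume eq: "f e = f e'"
    obtain v where v: "v \<in> e" "v \<in> e'" "e \<noteq> e'"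
      using e(3) by (auto simp: edges_adjacent_def)
    have "f (dir_edge (edge_dir e) v) = f (dir_edge (edge_dir e') v)"
      using eq e v by (simp add: edge_at_vertex)
    then have "edge_dir e = edge_dir e'"
      using inj_onD[OF inj[OF edge_at_vertex(1)[OF e(1) v(1)]]] e(1,2) edge_dir_in_range by blast
    then show False using e v edge_at_vertex(2) by metis
  qed
  with range show ?thesis unfolding proper_edge_coloring_def by blast
qed

subsection \<open>Switching edge-disjoint squares\<close>

definition square :: "edge \<Rightarrow> nat \<Rightarrow> edge set" where
  "square e j = {e, flip j ` e} \<union> dir_edge j ` e"

lemma dir_edge_in_square_iff:
  assumes "e \<in> Q_edges d" "j \<in> {1..d}"
  shows "dir_edge k v \<in> square e j \<longleftrightarrow> k \<in> {edge_dir e, j} \<and> v \<in> e \<union> flip j ` e"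
proof -
  obtain i u where u: "i \<in> {1..d}" "u \<in> Q_verts d" and e: "e = dir_edge i u"
    using assms(1) by (rule Q_edgesE)
  have "square e j = {dir_edge i u, dir_edge i (flip j u), dir_edge j u, dir_edge j (flip i u)}"
    unfolding square_def e image_flip_dir_edge by (auto simp: dir_edge_def)
  then have "dir_edge k v \<in> square e j \<longleftrightarrow>
      k = i \<and> v \<in> dir_edge i u \<union> dir_edge i (flip j u) \<or>
      k = j \<and> v \<in> dir_edge j u \<union> dir_edge j (flip i u)"
    using u assms(2) by (auto simp: dir_edge_eq_iff[where d = d] flip_in_Q_verts)
  moreover have "dir_edge i u \<union> dir_edge i (flip j u) = e \<union> flip j ` e"
    by (simp add: e image_flip_dir_edge)
  moreover have "dir_edge j u \<union> dir_edge j (flip i u) = e \<union> flip j ` e"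
    unfolding e by (auto simp: dir_edge_def)
  moreover have "edge_dir e = i"
    by (simp add: e)
  ultimately show ?thesis by auto
qed

lemma square_cases:
  assumes "e \<in> Q_edges d" "e' \<in> square e j"
  shows "e' \<in> {e, flip j ` e} \<and> edge_dir e' = edge_dir e \<or> edge_dir e' = j"
  using assms edge_dir_image_flip[OF assms(1)] by (auto simp: square_def)

lemma square_Int_same_edge:
  assumes "e \<in> Q_edges d" "j \<noteq> edge_dir e" "l \<noteq> edge_dir e" "j \<noteq> l"
  shows "square e j \<inter> square e l \<subseteq> {e}"
proof
  fix e' assume "e' \<in> square e j \<inter> square e l"
  then have "e' \<in> {e, flip j ` e}" "e' \<in> {e, flip l ` e}"
    using square_cases[OF assms(1)] assms(2-4) by (metis IntD1 IntD2)+
  then show "e' \<in> {e}"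
    using image_flip_eqD[OF assms(1-3)] assms(4) by auto
qed

lemma squares_disjoint:
  assumes "e \<in> Q_edges d" "g \<in> Q_edges d" "e \<noteq> g"
    and "j \<noteq> l" "j \<noteq> edge_dir g" "l \<noteq> edge_dir e"
    and "flip j ` e \<noteq> g" "flip l ` g \<noteq> e" "flip j ` e \<noteq> flip l ` g"
  shows "square e j \<inter> square g l = {}"
proof (rule equals0I)
  fix x assume "x \<in> square e j \<inter> square g l"
  then have "x \<in> {e, flip j ` e}" "x \<in> {g, flip l ` g}"
    using square_cases[OF assms(1)] square_cases[OF assms(2)] assms(4-6) by (metis IntD1 IntD2)+
  then show False using assms by auto
qed

locale disjoint_squares =
  fixes d :: nat and K :: "edge set" and J :: "edge \<Rightarrow> nat"
  assumes K_subset: "K \<subseteq> Q_edges d"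
    and J_in_range: "\<And>e. e \<in> K \<Longrightarrow> J e \<in> {1..d}"
    and disjoint: "disjoint_family_on (\<lambda>e. square e (J e)) K"
begin

definition switched_dir :: "edge \<Rightarrow> nat" where
  "switched_dir e' =
    (if \<exists>e\<in>K. e' \<in> square e (J e)
     then let e = THE e. e \<in> K \<and> e' \<in> square e (J e) in transpose (edge_dir e) (J e) (edge_dir e')
     else edge_dir e')"

lemma switched_dir_in_square:
  assumes "e \<in> K" "e' \<in> square e (J e)"
  shows "switched_dir e' = transpose (edge_dir e) (J e) (edge_dir e')"
proof -
  have "(THE e. e \<in> K \<and> e' \<in> square e (J e)) = e"
    using assms disjoint by (intro the_equality) (auto simp: disjoint_family_on_def)
  with assms show ?thesis unfolding switched_dir_def by auto
qed

lemma switched_dir_outside: "\<forall>e\<in>K. e' \<notin> square e (J e) \<Longrightarrow> switched_dir e' = edge_dir e'"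
  by (simp add: switched_dir_def)

lemma switched_dir_involution:
  "switched_dir (dir_edge (switched_dir (dir_edge k v)) v) = k"
proof (cases "\<exists>e\<in>K. dir_edge k v \<in> square e (J e)")
  case True
  then obtain e where e: "e \<in> K" and sq: "dir_edge k v \<in> square e (J e)"
    by blast
  have "e \<in> Q_edges d" using e K_subset by blast
  then have mem: "dir_edge i v \<in> square e (J e) \<longleftrightarrow> i \<in> {edge_dir e, J e} \<and> v \<in> e \<union> flip (J e) ` e"
    for i using dir_edge_in_square_iff J_in_range[OF e] by blast
  define l where "l = transpose (edge_dir e) (J e) k"
  have "k \<in> {edge_dir e, J e}" using sq mem by blast
  then have "l \<in> {edge_dir e, J e}" by (auto simp: l_def)
  then have "dir_edge l v \<in> square e (J e)" using sq mem by blast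
  then show ?thesis
    using switched_dir_in_square[OF e] sq by (simp add: l_def)
qed (simp add: switched_dir_outside)

lemma switched_dir_in_range:
  assumes "e' \<in> Q_edges d"
  shows "switched_dir e' \<in> {1..d}"
proof (cases "\<exists>e\<in>K. e' \<in> square e (J e)")
  case True
  then obtain e where e: "e \<in> K" "e' \<in> square e (J e)" by blast
  have "edge_dir e \<in> {1..d}"
    using e(1) K_subset edge_dir_in_range by blast
  then have "transpose (edge_dir e) (J e) permutes {1..d}"
    using J_in_range[OF e(1)] by (rule permutes_swap_id)
  then show ?thesis
    using edge_dir_in_range[OF assms] switched_dir_in_square[OF e] permutes_in_image by metis
qed (use assms switched_dir_outside edge_dir_in_range in metis)

lemma proper_edge_coloring_switched:
  assumes "p permutes {1..d}"
  shows "proper_edge_coloring d (\<lambda>e. p (switched_dir e))"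
proof (rule proper_edge_coloringI)
  show "p (switched_dir e) \<in> {1..d}" if "e \<in> Q_edges d" for e
    using assms switched_dir_in_range[OF that] permutes_in_image by metis
  show "inj_on (\<lambda>i. p (switched_dir (dir_edge i v))) {1..d}" for v
    by (rule inj_onI) (metis permutes_inj[OF assms] injD switched_dir_involution)
qed

end

subsection \<open>Choosing edge-disjoint squares greedily\<close>

lemma card_clashing_dirs_le:
  assumes "e \<in> Q_edges d" "finite A" "edge_dir e \<notin> A"
  shows "card {j \<in> A. j = l \<or> flip j ` e = e'} \<le> 2"
proof -
  let ?M = "{j \<in> A. flip j ` e = e'}"
  have "j = k" if "j \<in> ?M" "k \<in> ?M" for j k
    using that assms by (intro image_flip_eqD[OF assms(1)]) auto
  then have M: "card ?M \<le> 1"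
    using assms(2) by (simp add: card_le_Suc0_iff_eq)
  have "card {j \<in> A. j = l \<or> flip j ` e = e'} \<le> card (insert l ?M)"
    using assms(2) by (intro card_mono) auto
  also have "\<dots> \<le> 2"
    using M by (intro card_insert_le_m1) auto
  finally show ?thesis .
qed

lemma ex_disjoint_squares:
  assumes K: "finite K" "K \<subseteq> Q_edges d"
    and A: "\<And>e. e \<in> K \<Longrightarrow> A e \<subseteq> {1..d} - edge_dir ` K"
    and flip_notin: "\<And>e j. e \<in> K \<Longrightarrow> j \<in> A e \<Longrightarrow> flip j ` e \<notin> K"
    and many: "\<And>e. e \<in> K \<Longrightarrow> 2 * (card K - 1) < card (A e)"
  shows "\<exists>J \<in> Pi K A. disjoint_squares d K J"
proof -
  define clash where "clash e j g l \<longleftrightarrow> j = l \<or> flip j ` e = flip l ` g" for e g :: edge and j l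
  have "card {j \<in> A e. clash e j g l} \<le> 2" if e: "e \<in> K" for e g l
  proof -
    have "finite (A e)" using many[OF e] by (intro card_ge_0_finite) linarith
    then show ?thesis
      unfolding clash_def using A[OF e] e K(2) by (intro card_clashing_dirs_le[of e d]) auto
  qed
  then obtain J where J: "J \<in> Pi K A" "pairwise (\<lambda>e g. \<not> clash e (J e) g (J g)) K"
    using ex_pairwise_compatible_choice[OF K(1), of clash A 2] many by (auto simp: clash_def)
  have "disjoint_squares d K J"
  proof
    show "J e \<in> {1..d}" if "e \<in> K" for e
      using that J(1) A by blast
    show "disjoint_family_on (\<lambda>e. square e (J e)) K"
      unfolding disjoint_family_on_def
    proof (intro ballI impI)
      fix e g assume eg: "e \<in> K" "g \<in> K" "e \<noteq> g"
      then have "J e \<in> A e" "J g \<in> A g" using J(1) by auto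
      moreover from this have "J e \<noteq> edge_dir g" "J g \<noteq> edge_dir e"
        using A eg by blast+
      moreover have "\<not> clash e (J e) g (J g)"
        using J(2) eg by (simp add: pairwise_def)
      ultimately show "square e (J e) \<inter> square g (J g) = {}"
        using eg K(2) flip_notin by (intro squares_disjoint) (auto simp: clash_def)
    qed
  qed (fact K(2))
  with J(1) show ?thesis by blast
qed

subsection \<open>Permutations with few conflicts\<close>

definition conflicts :: "(edge \<rightharpoonup> nat) \<Rightarrow> (nat \<Rightarrow> nat) \<Rightarrow> edge set" where
  "conflicts \<phi> p = {e. \<phi> e = Some (p (edge_dir e))}"

definition blocked_dirs :: "nat \<Rightarrow> (edge \<rightharpoonup> nat) \<Rightarrow> (nat \<Rightarrow> nat) \<Rightarrow> edge \<Rightarrow> nat set" where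
  "blocked_dirs d \<phi> p e = {j \<in> {1..d} - {edge_dir e}. \<phi> (flip j ` e) = Some (p j)}"

lemma sum_card_conflicts_le:
  assumes "dom \<phi> \<subseteq> Q_edges d"
  shows "(\<Sum>p | p permutes {1..d}. card (conflicts \<phi> p)) \<le> card (dom \<phi>) * fact (d - 1)"
proof -
  let ?S = "{p. p permutes {1..d}}"
  have "card {p \<in> ?S. \<phi> e = Some (p (edge_dir e))} \<le> fact (d - 1)" if "e \<in> dom \<phi>" for e
    using card_permutes_prescribed_le[of "{1..d}" "{edge_dir e}" "\<lambda>_. \<phi> e"]
      that assms edge_dir_in_range by auto
  then have "(\<Sum>p | p permutes {1..d}. card {e \<in> dom \<phi>. \<phi> e = Some (p (edge_dir e))})
      \<le> card (dom \<phi>) * fact (d - 1)"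
    using assms finite_subset[OF assms finite_Q_edges]
    by (intro sum_card_le_double_counting) (auto simp: finite_permutations)
  moreover have "conflicts \<phi> p = {e \<in> dom \<phi>. \<phi> e = Some (p (edge_dir e))}" for p
    by (auto simp: conflicts_def)
  ultimately show ?thesis by simp
qed

lemma sum_card_blocked_dirs_le:
  assumes "dom \<phi> \<subseteq> Q_edges d"
  shows "(\<Sum>p | p permutes {1..d}. \<Sum>e\<in>conflicts \<phi> p. card (blocked_dirs d \<phi> p e))
    \<le> card (dom \<phi>) * fact (d - 1)"
proof -
  let ?S = "{p. p permutes {1..d}}"
  define pairs where "pairs = (SIGMA e:dom \<phi>. {1..d} - {edge_dir e})"
  define blocks where "blocks p =
    (\<lambda>(e, j). \<phi> e = Some (p (edge_dir e)) \<and> \<phi> (flip j ` e) = Some (p j))" for p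
  have fin: "finite (dom \<phi>)" using assms finite_Q_edges finite_subset by blast
  have dir: "edge_dir e \<in> {1..d}" if "e \<in> dom \<phi>" for e
    using that assms edge_dir_in_range by blast
  have "card {p \<in> ?S. blocks p x} \<le> fact (d - 2)" if x_in: "x \<in> pairs" for x
  proof -
    obtain e j where e: "e \<in> dom \<phi>" and j: "j \<in> {1..d} - {edge_dir e}" and x: "x = (e, j)"
      using x_in unfolding pairs_def by (rule SigmaE)
    then show ?thesis
      using card_permutes_prescribed_two_le[OF _ dir[OF e], of j "\<phi> e" "\<phi> (flip j ` e)"]
      by (auto simp: blocks_def)
  qed
  then have "(\<Sum>p | p permutes {1..d}. card {x \<in> pairs. blocks p x}) \<le> card pairs * fact (d - 2)"
    using fin by (intro sum_card_le_double_counting) (auto simp: finite_permutations pairs_def)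
  moreover have "(\<Sum>e\<in>conflicts \<phi> p. card (blocked_dirs d \<phi> p e))
      = card {x \<in> pairs. blocks p x}" for p
  proof -
    have "{x \<in> pairs. blocks p x} = (SIGMA e:conflicts \<phi> p. blocked_dirs d \<phi> p e)"
      by (auto simp: pairs_def blocks_def conflicts_def blocked_dirs_def)
    moreover have "finite (conflicts \<phi> p)"
      by (rule finite_subset[OF _ fin]) (auto simp: conflicts_def)
    ultimately show ?thesis by (simp add: blocked_dirs_def)
  qed
  moreover have "card pairs * fact (d - 2) \<le> card (dom \<phi>) * fact (d - 1)"
  proof -
    have "card pairs = card (dom \<phi>) * (d - 1)"
      using fin dir by (simp add: pairs_def)
    moreover have "(d - 1) * fact (d - 2) \<le> (fact (d - 1) :: nat)"
      by (cases d; cases "d - 1") simp_all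
    ultimately show ?thesis by (simp add: mult.assoc)
  qed
  ultimately show ?thesis by simp
qed

lemma ex_permutation_few_conflicts:
  assumes dom: "dom \<phi> \<subseteq> Q_edges d" and card_dom: "card (dom \<phi>) \<le> d * m"
  obtains p where "p permutes {1..d}"
    "3 * card (conflicts \<phi> p) + (\<Sum>e\<in>conflicts \<phi> p. card (blocked_dirs d \<phi> p e)) \<le> 4 * m"
proof -
  define S where "S = {p. p permutes {1..d}}"
  define cost where "cost p =
    3 * card (conflicts \<phi> p) + (\<Sum>e\<in>conflicts \<phi> p. card (blocked_dirs d \<phi> p e))" for p
  have finS: "finite S" and cardS: "card S = fact d"
    by (simp_all add: S_def finite_permutations card_permutations)
  have "id \<in> S" by (simp add: S_def)
  then have "S \<noteq> {}" by blast
  have "(\<Sum>p\<in>S. cost p) \<le> 4 * (card (dom \<phi>) * fact (d - 1))"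
    using sum_card_conflicts_le[OF dom] sum_card_blocked_dirs_le[OF dom]
    by (simp add: cost_def S_def sum.distrib flip: sum_distrib_left)
  also have "card (dom \<phi>) * fact (d - 1) \<le> d * m * fact (d - 1)"
    using card_dom by (rule mult_le_mono1)
  also have "\<dots> \<le> m * fact d"
    by (cases d) (simp_all add: algebra_simps)
  finally have "(\<Sum>p\<in>S. cost p) \<le> (\<Sum>p\<in>S. 4 * m)"
    by (simp add: cardS mult_ac)
  then obtain p where "p \<in> S" "cost p \<le> 4 * m"
    using sum_strict_mono[OF finS \<open>S \<noteq> {}\<close>, of "\<lambda>_. 4 * m" cost] by (meson not_le)
  then show ?thesis using that by (auto simp: S_def cost_def)
qed

subsection \<open>Small color classes\<close>

definition same_color_dirs :: "nat \<Rightarrow> (edge \<rightharpoonup> nat) \<Rightarrow> edge \<Rightarrow> nat set" where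
  "same_color_dirs d \<phi> e = {j \<in> {1..d} - {edge_dir e}. \<exists>e'\<in>square e j - {e}. \<phi> e' = \<phi> e}"

lemma card_same_color_dirs_le:
  assumes "e \<in> Q_edges d" and fin: "finite {e'. \<phi> e' = \<phi> e}"
  shows "card (same_color_dirs d \<phi> e) \<le> card {e'. \<phi> e' = \<phi> e}"
proof -
  have "\<forall>j\<in>same_color_dirs d \<phi> e. \<exists>e'. e' \<in> square e j - {e} \<and> \<phi> e' = \<phi> e"
    by (auto simp: same_color_dirs_def)
  then obtain w where w: "\<And>j. j \<in> same_color_dirs d \<phi> e \<Longrightarrow> w j \<in> square e j - {e} \<and> \<phi> (w j) = \<phi> e"
    by metis
  have "inj_on w (same_color_dirs d \<phi> e)"
  proof (rule inj_onI, rule ccontr)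
    fix j l assume jl: "j \<in> same_color_dirs d \<phi> e" "l \<in> same_color_dirs d \<phi> e" "w j = w l" "j \<noteq> l"
    then have "square e j \<inter> square e l \<subseteq> {e}"
      by (intro square_Int_same_edge[OF assms(1)]) (auto simp: same_color_dirs_def)
    with w[OF jl(1)] w[OF jl(2)] jl(3) show False by auto
  qed
  then show ?thesis
    using w fin by (intro card_inj_on_le) auto
qed

definition admissible_dirs :: "nat \<Rightarrow> (edge \<rightharpoonup> nat) \<Rightarrow> (nat \<Rightarrow> nat) \<Rightarrow> edge \<Rightarrow> nat set" where
  "admissible_dirs d \<phi> p e =
    {1..d} - (edge_dir ` conflicts \<phi> p \<union> blocked_dirs d \<phi> p e \<union> same_color_dirs d \<phi> e)"

lemma card_admissible_dirs_ge:
  assumes dom: "dom \<phi> \<subseteq> Q_edges d" and e: "e \<in> conflicts \<phi> p"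
  shows "d \<le> card (admissible_dirs d \<phi> p e) + card (conflicts \<phi> p)
    + card (blocked_dirs d \<phi> p e) + card {e'. \<phi> e' = \<phi> e}"
proof -
  let ?U = "edge_dir ` conflicts \<phi> p \<union> blocked_dirs d \<phi> p e \<union> same_color_dirs d \<phi> e"
  have e_dom: "e \<in> dom \<phi>" using e by (auto simp: conflicts_def)
  have fin: "finite (dom \<phi>)" using dom finite_Q_edges finite_subset by blast
  then have finK: "finite (conflicts \<phi> p)"
    by (rule finite_subset[rotated]) (auto simp: conflicts_def)
  have "card (same_color_dirs d \<phi> e) \<le> card {e'. \<phi> e' = \<phi> e}"
  proof (rule card_same_color_dirs_le)
    show "e \<in> Q_edges d" using e_dom dom by blast
    show "finite {e'. \<phi> e' = \<phi> e}"
      using e_dom by (intro finite_subset[OF _ fin]) auto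
  qed
  moreover have "card (edge_dir ` conflicts \<phi> p) \<le> card (conflicts \<phi> p)"
    using finK by (rule card_image_le)
  moreover have "card ?U \<le> card (edge_dir ` conflicts \<phi> p) + card (blocked_dirs d \<phi> p e)
      + card (same_color_dirs d \<phi> e)"
    by (meson add_right_mono card_Un_le order_trans)
  moreover have "finite ?U"
    using finK by (auto simp: blocked_dirs_def same_color_dirs_def)
  then have "d \<le> card (admissible_dirs d \<phi> p e) + card ?U"
    using diff_card_le_card_Diff[of ?U "{1..d}"] by (simp add: admissible_dirs_def)
  ultimately show ?thesis by linarith
qed

lemma image_flip_admissible_notin_conflicts:
  assumes e: "e \<in> conflicts \<phi> p" "e \<in> Q_edges d" and j: "j \<in> admissible_dirs d \<phi> p e"
  shows "flip j ` e \<notin> conflicts \<phi> p"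
proof
  assume "flip j ` e \<in> conflicts \<phi> p"
  then have "\<phi> (flip j ` e) = \<phi> e"
    using e edge_dir_image_flip by (simp add: conflicts_def)
  moreover have "flip j ` e \<noteq> e"
    using j e by (intro image_flip_neq[of _ d]) (auto simp: admissible_dirs_def)
  ultimately show False
    using e j by (auto simp: admissible_dirs_def same_color_dirs_def square_def)
qed

lemma switch_admissible_no_conflict:
  assumes e: "e \<in> conflicts \<phi> p" "e \<in> Q_edges d" and p: "p permutes {1..d}"
    and j: "j \<in> admissible_dirs d \<phi> p e" and e': "e' \<in> square e j"
  shows "\<phi> e' \<noteq> Some (p (transpose (edge_dir e) j (edge_dir e')))"
proof -
  have \<phi>e: "\<phi> e = Some (p (edge_dir e))" using e(1) by (simp add: conflicts_def)
  have j_range: "j \<in> {1..d}" and j_neq: "j \<noteq> edge_dir e"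
    and j_free: "j \<notin> blocked_dirs d \<phi> p e" "j \<notin> same_color_dirs d \<phi> e"
    using j e(1) by (auto simp: admissible_dirs_def)
  from e' consider (self) "e' = e" | (opposite) "e' = flip j ` e"
    | (crossing) "e' \<in> dir_edge j ` e" "e' \<noteq> e"
    by (auto simp: square_def)
  then show ?thesis
  proof cases
    case self
    then show ?thesis
      using \<phi>e j_neq inj_eq[OF permutes_inj[OF p]] by simp
  next
    case opposite
    then show ?thesis
      using j_range j_neq j_free(1) edge_dir_image_flip[OF e(2)] by (auto simp: blocked_dirs_def)
  next
    case crossing
    then show ?thesis
      using \<phi>e j_range j_neq j_free(2) e' by (auto simp: same_color_dirs_def)
  qed
qed

lemma avoidable_if_switches:
  assumes p: "p permutes {1..d}"
    and squares: "disjoint_squares d (conflicts \<phi> p) J"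
    and J: "\<And>e. e \<in> conflicts \<phi> p \<Longrightarrow> J e \<in> admissible_dirs d \<phi> p e"
  shows "avoidable d \<phi>"
proof -
  interpret disjoint_squares d "conflicts \<phi> p" J by (fact squares)
  have "\<phi> e' \<noteq> Some (p (switched_dir e'))" for e'
  proof (cases "\<exists>e\<in>conflicts \<phi> p. e' \<in> square e (J e)")
    case True
    then obtain e where e: "e \<in> conflicts \<phi> p" "e' \<in> square e (J e)" by blast
    then have "e \<in> Q_edges d" using K_subset by blast
    then show ?thesis
      using switch_admissible_no_conflict[OF e(1) _ p J[OF e(1)] e(2)]
      by (simp add: switched_dir_in_square[OF e])
  next
    case False
    then have "e' \<notin> conflicts \<phi> p" by (auto simp: square_def)
    then show ?thesis
      using False switched_dir_outside by (simp add: conflicts_def)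
  qed
  with proper_edge_coloring_switched[OF p] show ?thesis
    unfolding avoidable_def by blast
qed

text \<open>Every conflict edge excludes one direction for all the others, namely its own, and the greedy
  choice of its square excludes at most two more.\<close>

lemma avoidable_if_few_conflicts:
  assumes dom: "dom \<phi> \<subseteq> Q_edges d" and p: "p permutes {1..d}"
    and small: "\<And>e. e \<in> conflicts \<phi> p \<Longrightarrow> card {e'. \<phi> e' = \<phi> e} \<le> m"
    and few: "3 * card (conflicts \<phi> p) + (\<Sum>e\<in>conflicts \<phi> p. card (blocked_dirs d \<phi> p e)) + m < d"
  shows "avoidable d \<phi>"
proof -
  let ?K = "conflicts \<phi> p" and ?A = "admissible_dirs d \<phi> p"
  have "?K \<subseteq> dom \<phi>" by (auto simp: conflicts_def)
  then have K: "?K \<subseteq> Q_edges d" using dom by blast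
  then have finK: "finite ?K" using finite_Q_edges finite_subset by blast
  have many: "2 * (card ?K - 1) < card (?A e)" if e: "e \<in> ?K" for e
  proof -
    have "card (blocked_dirs d \<phi> p e) \<le> (\<Sum>e\<in>?K. card (blocked_dirs d \<phi> p e))"
      using e finK by (intro member_le_sum) auto
    then show ?thesis
      using card_admissible_dirs_ge[OF dom e] small[OF e] few by linarith
  qed
  have "\<exists>J \<in> Pi ?K ?A. disjoint_squares d ?K J"
  proof (rule ex_disjoint_squares[OF finK K])
    show "?A e \<subseteq> {1..d} - edge_dir ` ?K" for e
      by (auto simp: admissible_dirs_def)
    show "flip j ` e \<notin> ?K" if "e \<in> ?K" "j \<in> ?A e" for e j
      using that K image_flip_admissible_notin_conflicts by blast
  qed (fact many)
  then obtain J where "J \<in> Pi ?K ?A" "disjoint_squares d ?K J" by blast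
  then show ?thesis
    by (intro avoidable_if_switches[OF p]) auto
qed

theorem avoidable_if_small_color_classes:
  assumes \<phi>: "partial_edge_coloring d \<phi>" and "5 * m < d"
    and small: "\<And>c. c \<in> {1..d} \<Longrightarrow> card {e. \<phi> e = Some c} \<le> m"
  shows "avoidable d \<phi>"
proof -
  have dom: "dom \<phi> \<subseteq> Q_edges d" and ran: "ran \<phi> \<subseteq> {1..d}"
    using \<phi> by (auto simp: partial_edge_coloring_def)
  have "card (dom \<phi>) \<le> d * m"
    using card_dom_le_if_fibers_le[OF ran _ small] by simp
  then obtain p where p: "p permutes {1..d}"
    and few: "3 * card (conflicts \<phi> p) + (\<Sum>e\<in>conflicts \<phi> p. card (blocked_dirs d \<phi> p e)) \<le> 4 * m"
    using ex_permutation_few_conflicts[OF dom] by blast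
  show ?thesis
  proof (rule avoidable_if_few_conflicts[OF dom p])
    show "card {e'. \<phi> e' = \<phi> e} \<le> m" if "e \<in> conflicts \<phi> p" for e
      using that small ran by (force simp: conflicts_def intro: ranI)
    show "3 * card (conflicts \<phi> p) + (\<Sum>e\<in>conflicts \<phi> p. card (blocked_dirs d \<phi> p e)) + m < d"
      using few \<open>5 * m < d\<close> by linarith
  qed
qed

theorem theorem3p6:
  fixes d :: nat and \<phi> :: "edge \<rightharpoonup> nat" and a b :: "nat \<Rightarrow> real"
  assumes "d \<ge> 1"
    and "partial_edge_coloring d \<phi>"
    and "109 / 1776 * (real d)\<^sup>2 - 2 * b d * (a d - 7 * real d / 8) \<ge> 0"
    and "a d \<ge> b d"
  shows "((\<forall>c \<in> {1..d}. real (card {e. \<phi> e = Some c}) \<le> real d / 8) \<and>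
          (\<forall>e \<in> Q_edges d. real (card {e' \<in> dom \<phi> - {e}. parallel d e e'}) \<le> b d) \<and>
          (\<forall>i \<in> {1..d}. real (card (dom \<phi> \<inter> dim_matching d i)) \<le> a d)
            \<longrightarrow> avoidable d \<phi>)
       \<and> (\<forall>C1 C2 :: real. C1 \<ge> 1 \<longrightarrow> C2 = 2 * C1 * (C1 + 2) * 34\<^sup>2 \<longrightarrow>
            (\<forall>i \<in> {1..d}. real (card (dom \<phi> \<inter> dim_matching d i)) \<le> C1 * real d) \<longrightarrow>
            (\<forall>c \<in> {1..d}. real (card {e. \<phi> e = Some c}) \<le> real d / C2)
            \<longrightarrow> avoidable d \<phi>)"
proof -
  have "avoidable d \<phi>" if small: "\<forall>c \<in> {1..d}. real (card {e. \<phi> e = Some c}) \<le> real d / 8"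
  proof (rule avoidable_if_small_color_classes[OF assms(2), of "d div 8"])
    show "5 * (d div 8) < d" using assms(1) by linarith
    show "card {e. \<phi> e = Some c} \<le> d div 8" if "c \<in> {1..d}" for c
      using small that le_nat_floor by (force simp: floor_divide_of_nat_eq)
  qed
  moreover have "real d / C2 \<le> real d / 8"
    if "C1 \<ge> 1" "C2 = 2 * C1 * (C1 + 2) * 34\<^sup>2" for C1 C2 :: real
  proof -
    have "1 * 3 \<le> C1 * (C1 + 2)" using that(1) by (intro mult_mono) auto
    then have "8 \<le> C2" unfolding that(2) by simp
    then show ?thesis by (intro divide_left_mono) auto
  qed
  ultimately show ?thesis by (meson order_trans)
qed

end
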